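(* Let $n\ge1$, $1<p<\infty$ with $p\ne2$, let $\Theta\subset\mathbf{R}^{n+1}$ be a bounded nonempty open set, $\xi_0\in\partial\Theta$ and $a>0$. Then $\xi_0$ is regular with respect to $\Theta$ for the equation $\partial_t u=\Delta_p u$ if and only if $\xi_0$ is regular with respect to $\Theta$ for the multiplied equation $a\,\partial_t u=\Delta_p u$.
   Context: Points of $\mathbf{R}^{n+1}$ are written $(x,t)$ with $x\in\mathbf{R}^n$, $t\in\mathbf{R}$; $\nabla$ and $\operatorname{div}$ are taken with respect to $x$ only, and $\Delta_p u:=\operatorname{div}(|\nabla u|^{p-2}\nabla u)$. All notions below are defined relative to the equation $a\,\partial_t u=\Delta_p u$ with a constant $a>0$; the unmultiplied equation is the case $a=1$. For an open set $U\subset\mathbf{R}^n$ and $t_1<t_2$ let $U_{t_1,t_2}=U\times(t_1,t_2)$; $D'\Subset D$ means that $\overline{D'}$ is a compact subset of $D$. A function $u$ on $\Theta$ is a continuous weak solution if $u$ is continuous and, whenever $U_{t_1,t_2}\Subset\Theta$, one has $u\in L^p(t_1,t_2;W^{1,p}(U))$, $t\mapsto\int_U|u(x,t)|^2\,dx$ is continuous on $[t_1,t_2]$, and $\int_{t_1}^{t_2}\int_U|\nabla u|^{p-2}\nabla u\cdot\nabla\varphi\,dx\,dt-a\int_{t_1}^{t_2}\int_U u\,\partial_t\varphi\,dx\,dt=0$ for all $\varphi\in C_0^\infty(U_{t_1,t_2})$. A space-time box is $Q_{t_1,t_2}$ with $Q=(a_1,b_1)\times\cdots\times(a_n,b_n)$;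 its parabolic boundary is $\partial_pQ_{t_1,t_2}=(\overline{Q}\times\{t_1\})\cup(\partial Q\times(t_1,t_2])$. A function $u:\Theta\to(-\infty,\infty]$ is superparabolic (for the given equation) if (i) $u$ is lower semicontinuous; (ii) $u$ is finite in a dense subset of $\Theta$; (iii) for each space-time box $Q_{t_1,t_2}\Subset\Theta$: if $h$ is a continuous weak solution in $Q_{t_1,t_2}$, continuous on $\overline{Q}_{t_1,t_2}$ and $h\le u$ on $\partial_pQ_{t_1,t_2}$, then $h\le u$ in $Q_{t_1,t_2}$. For a bounded function $f:\partial\Theta\to\mathbf{R}$, the upper class is the set of all superparabolic functions $u$ on $\Theta$ which are bounded below and satisfy $\liminf_{\Theta\ni\eta\to\xi}u(\eta)\ge f(\xi)$ for all $\xi\in\partial\Theta$; the upper Perron solution of $f$ is the pointwise infimum over the upper class. A point $\xi_0\in\partial\Theta$ is \emph{regular} with respect to $\Theta$ (for the given equation) if, for every continuous $f:\partial\Theta\to\mathbf{R}$, the upper Perron solution of $f$ tends to $f(\xi_0)$ as $\Theta\ni\xi\to\xi_0$. *)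

theory Defs
  imports "HOL-Analysis.Analysis"
begin

definition compactly_contained :: "'a::euclidean_space set \<Rightarrow> 'a set \<Rightarrow> bool"
    (infix \<open>\<Subset>\<close> 50)
  where "D' \<Subset> D \<longleftrightarrow> compact (closure D') \<and> closure D' \<subseteq> D"

text \<open>\<open>C\<^sup>k\<close> functions on the whole space, via iterated partial derivatives.\<close>

primrec C_k :: "nat \<Rightarrow> ('a::euclidean_space \<Rightarrow> real) \<Rightarrow> bool" where
  "C_k 0 f \<longleftrightarrow> continuous_on UNIV f"
| "C_k (Suc k) f \<longleftrightarrow> (\<forall>x. f differentiable (at x)) \<and>
     (\<forall>i\<in>Basis. C_k k (\<lambda>x. frechet_derivative f (at x) i))"

text \<open>\<open>C\<^sub>0\<^sup>\<infinity>(\<Omega>)\<close>; a test function is identified with its extension by zero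
  to the whole space.\<close>

definition test_functions :: "'a::euclidean_space set \<Rightarrow> ('a \<Rightarrow> real) set" where
  "test_functions \<Omega> = {\<phi>. (\<forall>k. C_k k \<phi>) \<and> {x. \<phi> x \<noteq> 0} \<Subset> \<Omega>}"

definition grad :: "(real^'n \<Rightarrow> real) \<Rightarrow> real^'n \<Rightarrow> real^'n" where
  "grad f x = (\<chi> i. frechet_derivative f (at x) (axis i 1))"

definition L_p :: "real \<Rightarrow> 'a::euclidean_space set \<Rightarrow> ('a \<Rightarrow> 'b::euclidean_space) \<Rightarrow> bool" where
  "L_p p S f \<longleftrightarrow> set_borel_measurable lebesgue S f \<and>
     set_integrable lebesgue S (\<lambda>x. norm (f x) powr p)"

text \<open>\<open>u \<in> W\<^sup>1\<^sup>,\<^sup>p(U)\<close> with distributional gradient \<open>g\<close> (which is unique almost everywhere).\<close>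

definition sobolev_with_gradient ::
  "real \<Rightarrow> (real^'n) set \<Rightarrow> (real^'n \<Rightarrow> real) \<Rightarrow> (real^'n \<Rightarrow> real^'n) \<Rightarrow> bool" where
  "sobolev_with_gradient p U u g \<longleftrightarrow> L_p p U u \<and> L_p p U g \<and>
     (\<forall>\<psi>\<in>test_functions U.
        (LINT x:U|lebesgue. u x *\<^sub>R grad \<psi> x) = - (LINT x:U|lebesgue. \<psi> x *\<^sub>R g x))"

text \<open>\<open>u \<in> L\<^sup>p(t\<^sub>1,t\<^sub>2;W\<^sup>1\<^sup>,\<^sup>p(U))\<close> with spatial gradient \<open>g\<close>: measurable, with
  \<open>u(\<cdot>,t) \<in> W\<^sup>1\<^sup>,\<^sup>p(U)\<close> for almost every \<open>t\<close> and with \<open>|u|\<^sup>p + |\<nabla>u|\<^sup>p\<close> integrable over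
  \<open>U \<times> (t\<^sub>1,t\<^sub>2)\<close>.\<close>

definition parabolic_sobolev_with_gradient ::
  "real \<Rightarrow> (real^'n) set \<Rightarrow> real \<Rightarrow> real \<Rightarrow> ((real^'n) \<times> real \<Rightarrow> real) \<Rightarrow>
     ((real^'n) \<times> real \<Rightarrow> real^'n) \<Rightarrow> bool" where
  "parabolic_sobolev_with_gradient p U t\<^sub>1 t\<^sub>2 u g \<longleftrightarrow>
     L_p p (U \<times> {t\<^sub>1<..<t\<^sub>2}) u \<and> L_p p (U \<times> {t\<^sub>1<..<t\<^sub>2}) g \<and>
     (AE t in lebesgue. t \<in> {t\<^sub>1<..<t\<^sub>2} \<longrightarrow>
        sobolev_with_gradient p U (\<lambda>x. u (x, t)) (\<lambda>x. g (x, t)))"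

text \<open>Continuous weak solutions of \<open>a \<partial>\<^sub>t u = \<Delta>\<^sub>p u\<close> in \<open>\<Theta>\<close>. The gradient \<open>g = \<nabla>u\<close> is
  determined almost everywhere in \<open>U \<times> (t\<^sub>1,t\<^sub>2)\<close>, so the existential quantifier over \<open>g\<close> only
  expresses that \<open>u\<close> lies in the parabolic Sobolev space. Where \<open>g\<close> vanishes, the field
  \<open>|\<nabla>u|\<^sup>p\<^sup>-\<^sup>2\<nabla>u\<close> is zero for every \<open>p > 1\<close>.\<close>

definition continuous_weak_solution ::
  "real \<Rightarrow> real \<Rightarrow> ((real^'n) \<times> real) set \<Rightarrow> ((real^'n) \<times> real \<Rightarrow> real) \<Rightarrow> bool" where
  "continuous_weak_solution a p \<Theta> u \<longleftrightarrow> continuous_on \<Theta> u \<and>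
     (\<forall>U t\<^sub>1 t\<^sub>2. open U \<and> t\<^sub>1 < t\<^sub>2 \<and> U \<times> {t\<^sub>1<..<t\<^sub>2} \<Subset> \<Theta> \<longrightarrow>
        continuous_on {t\<^sub>1..t\<^sub>2} (\<lambda>t. LINT x:U|lebesgue. \<bar>u (x, t)\<bar>\<^sup>2) \<and>
        (\<exists>g. parabolic_sobolev_with_gradient p U t\<^sub>1 t\<^sub>2 u g \<and>
          (\<forall>\<phi>\<in>test_functions (U \<times> {t\<^sub>1<..<t\<^sub>2}).
            (LINT t:{t\<^sub>1<..<t\<^sub>2}|lebesgue. LINT x:U|lebesgue.
               (norm (g (x, t)) powr (p - 2) *\<^sub>R g (x, t)) \<bullet> grad (\<lambda>y. \<phi> (y, t)) x)
            - a * (LINT t:{t\<^sub>1<..<t\<^sub>2}|lebesgue. LINT x:U|lebesgue.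
               u (x, t) * deriv (\<lambda>s. \<phi> (x, s)) t) = 0)))"

definition parabolic_boundary ::
  "(real^'n) set \<Rightarrow> real \<Rightarrow> real \<Rightarrow> ((real^'n) \<times> real) set" where
  "parabolic_boundary Q t\<^sub>1 t\<^sub>2 = closure Q \<times> {t\<^sub>1} \<union> frontier Q \<times> {t\<^sub>1<..t\<^sub>2}"

definition lower_semicontinuous_on :: "'a::topological_space set \<Rightarrow> ('a \<Rightarrow> ereal) \<Rightarrow> bool" where
  "lower_semicontinuous_on S u \<longleftrightarrow> (\<forall>c::real. openin (top_of_set S) {z \<in> S. ereal c < u z})"

text \<open>Functions on \<open>\<Theta>\<close> are represented by total functions whose values outside \<open>\<Theta>\<close> are
  irrelevant.\<close>

definition superparabolic ::
  "real \<Rightarrow> real \<Rightarrow> ((real^'n) \<times> real) set \<Rightarrow> ((real^'n) \<times> real \<Rightarrow> ereal) \<Rightarrow> bool" where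
  "superparabolic a p \<Theta> u \<longleftrightarrow>
     (\<forall>z\<in>\<Theta>. u z \<noteq> -\<infinity>) \<and>
     lower_semicontinuous_on \<Theta> u \<and>
     \<Theta> \<subseteq> closure {z \<in> \<Theta>. \<bar>u z\<bar> \<noteq> \<infinity>} \<and>
     (\<forall>l r t\<^sub>1 t\<^sub>2 h.
        (\<forall>i. l $ i < r $ i) \<and> t\<^sub>1 < t\<^sub>2 \<and> box l r \<times> {t\<^sub>1<..<t\<^sub>2} \<Subset> \<Theta> \<and>
        continuous_weak_solution a p (box l r \<times> {t\<^sub>1<..<t\<^sub>2}) h \<and>
        continuous_on (closure (box l r \<times> {t\<^sub>1<..<t\<^sub>2})) h \<and>
        (\<forall>z\<in>parabolic_boundary (box l r) t\<^sub>1 t\<^sub>2. ereal (h z) \<le> u z)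
        \<longrightarrow> (\<forall>z\<in>box l r \<times> {t\<^sub>1<..<t\<^sub>2}. ereal (h z) \<le> u z))"

definition upper_class ::
  "real \<Rightarrow> real \<Rightarrow> ((real^'n) \<times> real) set \<Rightarrow> ((real^'n) \<times> real \<Rightarrow> real) \<Rightarrow>
     ((real^'n) \<times> real \<Rightarrow> ereal) set" where
  "upper_class a p \<Theta> f = {u. superparabolic a p \<Theta> u \<and>
     (\<exists>c::real. \<forall>z\<in>\<Theta>. ereal c \<le> u z) \<and>
     (\<forall>\<xi>\<in>frontier \<Theta>. ereal (f \<xi>) \<le> Liminf (at \<xi> within \<Theta>) u)}"

definition upper_perron ::
  "real \<Rightarrow> real \<Rightarrow> ((real^'n) \<times> real) set \<Rightarrow> ((real^'n) \<times> real \<Rightarrow> real) \<Rightarrow>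
     (real^'n) \<times> real \<Rightarrow> ereal" where
  "upper_perron a p \<Theta> f z = (INF u\<in>upper_class a p \<Theta> f. u z)"

text \<open>For bounded \<open>\<Theta>\<close> the boundary is compact, so continuous boundary data are bounded.\<close>

definition regular_boundary_point ::
  "real \<Rightarrow> real \<Rightarrow> ((real^'n) \<times> real) set \<Rightarrow> (real^'n) \<times> real \<Rightarrow> bool" where
  "regular_boundary_point a p \<Theta> \<xi>\<^sub>0 \<longleftrightarrow> \<xi>\<^sub>0 \<in> frontier \<Theta> \<and>
     (\<forall>f. continuous_on (frontier \<Theta>) f \<longrightarrow>
        (upper_perron a p \<Theta> f \<longlongrightarrow> ereal (f \<xi>\<^sub>0)) (at \<xi>\<^sub>0 within \<Theta>))"

end

theory Submission
  imports Defs
begin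

text \<open>The two equations differ by a change of scale: as \<open>\<Delta>\<^sub>p\<close> is homogeneous of degree
  \<open>p - 1\<close>, multiplication by \<open>k > 0\<close> turns solutions of \<open>a \<partial>\<^sub>t u = \<Delta>\<^sub>p u\<close> into solutions of
  \<open>a k\<^sup>p\<^sup>-\<^sup>2 \<partial>\<^sub>t u = \<Delta>\<^sub>p u\<close>, and it maps the corresponding superparabolic functions, upper classes
  and Perron solutions onto each other. For \<open>p \<noteq> 2\<close> the factor \<open>k\<^sup>p\<^sup>-\<^sup>2\<close> takes every positive
  value.\<close>

lemma L_p_scale:
  assumes "L_p p S f"
  shows "L_p p S (\<lambda>x. k *\<^sub>R f x)"
proof -
  have "(\<lambda>x. norm (k *\<^sub>R f x) powr p) = (\<lambda>x. (\<bar>k\<bar> powr p) * norm (f x) powr p)"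
    by (simp add: powr_mult)
  \<comment> \<open>\<open>set_borel_measurable\<close> puts the indicator of \<open>S\<close>
    outermost, so \<open>k\<close> is first commuted past it.\<close>
  moreover have "set_borel_measurable lebesgue S (\<lambda>x. k *\<^sub>R f x)"
    using assms unfolding L_p_def set_borel_measurable_def scaleR_left_commute[of _ k]
    by (rule borel_measurable_scaleR[OF borel_measurable_const conjunct1])
  ultimately show ?thesis
    using assms unfolding L_p_def by simp
qed

lemma sobolev_with_gradient_scale:
  assumes "sobolev_with_gradient p U u g"
  shows "sobolev_with_gradient p U (\<lambda>x. k * u x) (\<lambda>x. k *\<^sub>R g x)"
proof -
  have "(LINT x:U|lebesgue. (k * u x) *\<^sub>R grad \<psi> x) = k *\<^sub>R (LINT x:U|lebesgue. u x *\<^sub>R grad \<psi> x)" for \<psi>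
    by (simp only: scaleR_scaleR[symmetric] set_integral_scaleR_right)
  moreover have "(LINT x:U|lebesgue. \<psi> x *\<^sub>R k *\<^sub>R g x) = k *\<^sub>R (LINT x:U|lebesgue. \<psi> x *\<^sub>R g x)" for \<psi>
    by (simp only: scaleR_left_commute[of _ k] set_integral_scaleR_right)
  ultimately show ?thesis
    using assms L_p_scale[of p U u k] L_p_scale[of p U g k]
    unfolding sobolev_with_gradient_def by simp
qed

lemma parabolic_sobolev_with_gradient_scale:
  assumes "parabolic_sobolev_with_gradient p U t\<^sub>1 t\<^sub>2 u g"
  shows "parabolic_sobolev_with_gradient p U t\<^sub>1 t\<^sub>2 (\<lambda>z. k * u z) (\<lambda>z. k *\<^sub>R g z)"
  unfolding parabolic_sobolev_with_gradient_def
proof (intro conjI)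
  show "L_p p (U \<times> {t\<^sub>1<..<t\<^sub>2}) (\<lambda>z. k * u z)" "L_p p (U \<times> {t\<^sub>1<..<t\<^sub>2}) (\<lambda>z. k *\<^sub>R g z)"
    using assms L_p_scale[where k = k and f = u] L_p_scale[where k = k and f = g]
    unfolding parabolic_sobolev_with_gradient_def real_scaleR_def by blast+
  have "AE t in lebesgue. t \<in> {t\<^sub>1<..<t\<^sub>2} \<longrightarrow>
      sobolev_with_gradient p U (\<lambda>x. u (x, t)) (\<lambda>x. g (x, t))"
    using assms unfolding parabolic_sobolev_with_gradient_def by blast
  then show "AE t in lebesgue. t \<in> {t\<^sub>1<..<t\<^sub>2} \<longrightarrow>
      sobolev_with_gradient p U (\<lambda>x. k * u (x, t)) (\<lambda>x. k *\<^sub>R g (x, t))"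
    by (rule eventually_mono) (intro impI sobolev_with_gradient_scale, rule mp)
qed

text \<open>The flux is homogeneous of degree \<open>p - 1\<close>, so its integral gains the factor
  \<open>k powr (p - 2) * k\<close>. The time term gains only \<open>k\<close> from
  \<open>u\<close>; the new coefficient supplies the missing \<open>k powr (p - 2)\<close>, and the
  whole weak identity is multiplied by one constant.\<close>

lemma continuous_weak_solution_scale:
  assumes "0 < k" and sol: "continuous_weak_solution a p \<Theta> u"
  shows "continuous_weak_solution (a * k powr (p - 2)) p \<Theta> (\<lambda>z. k * u z)"
  unfolding continuous_weak_solution_def
proof (intro conjI allI impI)
  show "continuous_on \<Theta> (\<lambda>z. k * u z)"
    using sol unfolding continuous_weak_solution_def by (blast intro: continuous_on_mult_left)
  fix U t\<^sub>1 t\<^sub>2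
  assume U: "open U \<and> t\<^sub>1 < t\<^sub>2 \<and> U \<times> {t\<^sub>1<..<t\<^sub>2} \<Subset> \<Theta>"
  note sol_U = sol[unfolded continuous_weak_solution_def, THEN conjunct2, rule_format, OF U]
  have "continuous_on {t\<^sub>1..t\<^sub>2} (\<lambda>t. k\<^sup>2 * (LINT x:U|lebesgue. \<bar>u (x, t)\<bar>\<^sup>2))"
    by (intro continuous_on_mult_left conjunct1[OF sol_U])
  then show "continuous_on {t\<^sub>1..t\<^sub>2} (\<lambda>t. LINT x:U|lebesgue. \<bar>k * u (x, t)\<bar>\<^sup>2)"
    by (simp add: power_mult_distrib)
  obtain g where g: "parabolic_sobolev_with_gradient p U t\<^sub>1 t\<^sub>2 u g"
    and weak: "\<And>\<phi>. \<phi> \<in> test_functions (U \<times> {t\<^sub>1<..<t\<^sub>2}) \<Longrightarrow>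
            (LINT t:{t\<^sub>1<..<t\<^sub>2}|lebesgue. LINT x:U|lebesgue.
               (norm (g (x, t)) powr (p - 2) *\<^sub>R g (x, t)) \<bullet> grad (\<lambda>y. \<phi> (y, t)) x)
            - a * (LINT t:{t\<^sub>1<..<t\<^sub>2}|lebesgue. LINT x:U|lebesgue.
               u (x, t) * deriv (\<lambda>s. \<phi> (x, s)) t) = 0"
    using conjunct2[OF sol_U] by blast
  \<comment> \<open>Positivity of \<open>k\<close> removes the absolute value in the norm; where
    \<open>g z = 0\<close> both sides vanish.\<close>
  have flux: "(norm (k *\<^sub>R g z) powr (p - 2) *\<^sub>R k *\<^sub>R g z) \<bullet> v
      = (k powr (p - 2) * k) * ((norm (g z) powr (p - 2) *\<^sub>R g z) \<bullet> v)" for z v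
    using \<open>0 < k\<close> by (simp add: powr_mult)
  show "\<exists>g. parabolic_sobolev_with_gradient p U t\<^sub>1 t\<^sub>2 (\<lambda>z. k * u z) g \<and>
          (\<forall>\<phi>\<in>test_functions (U \<times> {t\<^sub>1<..<t\<^sub>2}).
            (LINT t:{t\<^sub>1<..<t\<^sub>2}|lebesgue. LINT x:U|lebesgue.
               (norm (g (x, t)) powr (p - 2) *\<^sub>R g (x, t)) \<bullet> grad (\<lambda>y. \<phi> (y, t)) x)
            - a * k powr (p - 2) * (LINT t:{t\<^sub>1<..<t\<^sub>2}|lebesgue. LINT x:U|lebesgue.
               k * u (x, t) * deriv (\<lambda>s. \<phi> (x, s)) t) = 0)"
  proof (intro exI conjI ballI)
    show "parabolic_sobolev_with_gradient p U t\<^sub>1 t\<^sub>2 (\<lambda>z. k * u z) (\<lambda>z. k *\<^sub>R g z)"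
      by (rule parabolic_sobolev_with_gradient_scale[OF g])
    fix \<phi>
    assume "\<phi> \<in> test_functions (U \<times> {t\<^sub>1<..<t\<^sub>2})"
    note eq = weak[OF this]
    \<comment> \<open>Constants leave both iterated integrals without an integrability check,
      because a non-integrable function has integral 0 by convention. What remains is a multiple of
      \<open>eq\<close>.\<close>
    show "(LINT t:{t\<^sub>1<..<t\<^sub>2}|lebesgue. LINT x:U|lebesgue.
               (norm (k *\<^sub>R g (x, t)) powr (p - 2) *\<^sub>R k *\<^sub>R g (x, t)) \<bullet> grad (\<lambda>y. \<phi> (y, t)) x)
            - a * k powr (p - 2) * (LINT t:{t\<^sub>1<..<t\<^sub>2}|lebesgue. LINT x:U|lebesgue.
               k * u (x, t) * deriv (\<lambda>s. \<phi> (x, s)) t) = 0"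
      unfolding flux mult.assoc[of k "u _"] set_integral_mult_right
      using eq by (simp add: algebra_simps)
  qed
qed

text \<open>Scaling by \<open>k\<close> and then by \<open>inverse k\<close> restores the
  coefficient, so every scaling step can be reversed.\<close>

lemma powr_mult_inverse_powr_cancel:
  fixes k :: real
  assumes "0 < k"
  shows "a * k powr q * inverse k powr q = a"
  using assms by (simp add: inverse_powr)

text \<open>A finite positive factor fixes both infinite values, so it can be moved across
  inequalities as for reals.\<close>

lemma ereal_le_cmult_iff:
  assumes "0 < k"
  shows "x \<le> ereal k * y \<longleftrightarrow> ereal (inverse k) * x \<le> y"
    and "x < ereal k * y \<longleftrightarrow> ereal (inverse k) * x < y"
  using assms by (cases x; cases y; simp add: field_simps)+

text \<open>The comparison condition runs in the opposite direction: a competitor \<open>h\<close>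
  for the scaled equation is divided by \<open>k\<close>, compared with \<open>u\<close> for the
  original equation, and scaled up again.\<close>

lemma superparabolic_scale:
  fixes \<Theta> :: "((real^'n) \<times> real) set"
  assumes "0 < k" and u: "superparabolic a p \<Theta> u"
  shows "superparabolic (a * k powr (p - 2)) p \<Theta> (\<lambda>z. ereal k * u z)"
  unfolding superparabolic_def
proof (intro conjI allI impI)
  show "\<forall>z\<in>\<Theta>. ereal k * u z \<noteq> -\<infinity>"
    using u \<open>0 < k\<close> unfolding superparabolic_def by auto
  show "lower_semicontinuous_on \<Theta> (\<lambda>z. ereal k * u z)"
    using u \<open>0 < k\<close> unfolding superparabolic_def lower_semicontinuous_on_def
    by (simp add: ereal_le_cmult_iff)
  have "\<bar>ereal k * y\<bar> \<noteq> \<infinity> \<longleftrightarrow> \<bar>y\<bar> \<noteq> \<infinity>" for y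
    using \<open>0 < k\<close> by (cases y) auto
  then show "\<Theta> \<subseteq> closure {z \<in> \<Theta>. \<bar>ereal k * u z\<bar> \<noteq> \<infinity>}"
    using u unfolding superparabolic_def by simp
  fix l r :: "real^'n" and t\<^sub>1 t\<^sub>2 :: real and h :: "(real^'n) \<times> real \<Rightarrow> real"
  let ?B = "box l r \<times> {t\<^sub>1<..<t\<^sub>2}"
  assume h: "(\<forall>i. l $ i < r $ i) \<and> t\<^sub>1 < t\<^sub>2 \<and> ?B \<Subset> \<Theta> \<and>
      continuous_weak_solution (a * k powr (p - 2)) p ?B h \<and> continuous_on (closure ?B) h \<and>
      (\<forall>z\<in>parabolic_boundary (box l r) t\<^sub>1 t\<^sub>2. ereal (h z) \<le> ereal k * u z)"
  have "continuous_weak_solution (a * k powr (p - 2) * inverse k powr (p - 2)) p ?B (\<lambda>z. inverse k * h z)"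
    using h \<open>0 < k\<close> by (intro continuous_weak_solution_scale) auto
  then have "continuous_weak_solution a p ?B (\<lambda>z. inverse k * h z)"
    by (simp only: powr_mult_inverse_powr_cancel[OF \<open>0 < k\<close>])
  moreover have "continuous_on (closure ?B) (\<lambda>z. inverse k * h z)"
    using h by (blast intro: continuous_on_mult_left)
  ultimately have "\<forall>z\<in>?B. ereal (inverse k * h z) \<le> u z"
    using u h unfolding superparabolic_def ereal_le_cmult_iff[OF \<open>0 < k\<close>] times_ereal.simps by blast
  then show "\<forall>z\<in>?B. ereal (h z) \<le> ereal k * u z"
    by (simp only: ereal_le_cmult_iff[OF \<open>0 < k\<close>] times_ereal.simps)
qed

lemma upper_class_scale:
  assumes "0 < k" and u: "u \<in> upper_class a p \<Theta> f"
  shows "(\<lambda>z. ereal k * u z) \<in> upper_class (a * k powr (p - 2)) p \<Theta> (\<lambda>z. k * f z)"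
  unfolding upper_class_def
proof (intro CollectI conjI ballI)
  show "superparabolic (a * k powr (p - 2)) p \<Theta> (\<lambda>z. ereal k * u z)"
    using assms superparabolic_scale unfolding upper_class_def by blast
  obtain c where "\<forall>z\<in>\<Theta>. ereal c \<le> u z"
    using u unfolding upper_class_def by blast
  then show "\<exists>c. \<forall>z\<in>\<Theta>. ereal c \<le> ereal k * u z"
    using \<open>0 < k\<close>
    by (intro exI[of _ "k * c"]) (simp add: ereal_le_cmult_iff mult.assoc[symmetric])
  fix \<xi>
  assume "\<xi> \<in> frontier \<Theta>"
  then have "ereal (f \<xi>) \<le> Liminf (at \<xi> within \<Theta>) u"
    using u unfolding upper_class_def by blast
  \<comment> \<open>If the punctured filter at \<open>\<xi>\<close> is trivial, the
    \<open>Liminf\<close> is infinite; otherwise the positive factor commutes with it.\<close>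
  then show "ereal (k * f \<xi>) \<le> Liminf (at \<xi> within \<Theta>) (\<lambda>z. ereal k * u z)"
    using \<open>0 < k\<close>
    by (cases "at \<xi> within \<Theta> = bot")
      (simp_all add: Liminf_ereal_mult_left ereal_le_cmult_iff mult.assoc[symmetric])
qed

text \<open>Every member of the upper class of \<open>f\<close>, once scaled, competes in the
  infimum for \<open>k * f\<close>.\<close>

lemma upper_perron_scale_le:
  assumes "0 < k"
  shows "upper_perron (a * k powr (p - 2)) p \<Theta> (\<lambda>z. k * f z) z \<le> ereal k * upper_perron a p \<Theta> f z"
  unfolding ereal_le_cmult_iff[OF assms] upper_perron_def[of a]
proof (rule INF_greatest)
  fix u
  assume "u \<in> upper_class a p \<Theta> f"
  then have "upper_perron (a * k powr (p - 2)) p \<Theta> (\<lambda>z. k * f z) z \<le> ereal k * u z"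
    unfolding upper_perron_def by (rule INF_lower2[OF upper_class_scale[OF assms]]) simp
  then show "ereal (inverse k) * upper_perron (a * k powr (p - 2)) p \<Theta> (\<lambda>z. k * f z) z \<le> u z"
    by (simp only: ereal_le_cmult_iff[OF assms])
qed

text \<open>The reverse inequality is \<open>upper_perron_scale_le\<close> for the factor
  \<open>inverse k\<close> and the data \<open>k * f\<close>.\<close>

lemma upper_perron_scale:
  assumes "0 < k"
  shows "upper_perron (a * k powr (p - 2)) p \<Theta> (\<lambda>z. k * f z) z = ereal k * upper_perron a p \<Theta> f z"
proof (rule antisym[OF upper_perron_scale_le[OF assms]])
  have "(\<lambda>z. inverse k * (k * f z)) = f"
    using assms by (simp add: fun_eq_iff)
  then have "upper_perron a p \<Theta> f z
      \<le> ereal (inverse k) * upper_perron (a * k powr (p - 2)) p \<Theta> (\<lambda>z. k * f z) z"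
    using upper_perron_scale_le[of "inverse k" "a * k powr (p - 2)" p \<Theta> "\<lambda>z. k * f z" z] assms
    by (simp only: powr_mult_inverse_powr_cancel inverse_positive_iff_positive)
  then show "ereal k * upper_perron a p \<Theta> f z
      \<le> upper_perron (a * k powr (p - 2)) p \<Theta> (\<lambda>z. k * f z) z"
    using assms ereal_le_cmult_iff(1)[of "inverse k"] by simp
qed

lemma regular_boundary_point_scale:
  fixes \<Theta> :: "((real^'n) \<times> real) set"
  assumes "0 < k" and reg: "regular_boundary_point a p \<Theta> \<xi>\<^sub>0"
  shows "regular_boundary_point (a * k powr (p - 2)) p \<Theta> \<xi>\<^sub>0"
  unfolding regular_boundary_point_def
proof (intro conjI allI impI)
  show "\<xi>\<^sub>0 \<in> frontier \<Theta>"
    using reg unfolding regular_boundary_point_def by blast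
  fix f :: "(real^'n) \<times> real \<Rightarrow> real"
  assume "continuous_on (frontier \<Theta>) f"
  \<comment> \<open>Regularity for the coefficient \<open>a\<close> is applied to the data divided
    by \<open>k\<close>; scaling the Perron solution back recovers \<open>f\<close>.\<close>
  then have "continuous_on (frontier \<Theta>) (\<lambda>z. inverse k * f z)"
    by (intro continuous_intros)
  then have "(upper_perron a p \<Theta> (\<lambda>z. inverse k * f z) \<longlongrightarrow> ereal (inverse k * f \<xi>\<^sub>0)) (at \<xi>\<^sub>0 within \<Theta>)"
    using reg unfolding regular_boundary_point_def by blast
  then have "((\<lambda>z. ereal k * upper_perron a p \<Theta> (\<lambda>z. inverse k * f z) z)
      \<longlongrightarrow> ereal k * ereal (inverse k * f \<xi>\<^sub>0)) (at \<xi>\<^sub>0 within \<Theta>)"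
    by (intro tendsto_cmult_ereal) simp_all
  moreover have "(\<lambda>z. k * (inverse k * f z)) = f"
    using \<open>0 < k\<close> by (simp add: fun_eq_iff)
  moreover have "ereal k * ereal (inverse k * f \<xi>\<^sub>0) = ereal (f \<xi>\<^sub>0)"
    using \<open>0 < k\<close> by simp
  ultimately show "(upper_perron (a * k powr (p - 2)) p \<Theta> f \<longlongrightarrow> ereal (f \<xi>\<^sub>0)) (at \<xi>\<^sub>0 within \<Theta>)"
    by (simp only: upper_perron_scale[OF \<open>0 < k\<close>, symmetric])
qed

theorem theorem3p6:
  fixes \<Theta> :: "((real^'n) \<times> real) set" and \<xi>\<^sub>0 :: "(real^'n) \<times> real" and a p :: real
  assumes "1 < p" and "p \<noteq> 2"
    and "open \<Theta>" and "bounded \<Theta>" and "\<Theta> \<noteq> {}"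
    and "\<xi>\<^sub>0 \<in> frontier \<Theta>"
    and "0 < a"
  shows "regular_boundary_point 1 p \<Theta> \<xi>\<^sub>0 \<longleftrightarrow> regular_boundary_point a p \<Theta> \<xi>\<^sub>0"
proof
  \<comment> \<open>This solves \<open>k powr (p - 2) = a\<close>; the exponent makes sense because
    \<open>p \<noteq> 2\<close>.\<close>
  define k where "k = a powr (1 / (p - 2))"
  have k: "0 < k" "k powr (p - 2) = a"
    using \<open>0 < a\<close> \<open>p \<noteq> 2\<close> by (simp_all add: k_def powr_powr)
  show "regular_boundary_point a p \<Theta> \<xi>\<^sub>0" if "regular_boundary_point 1 p \<Theta> \<xi>\<^sub>0"
    using regular_boundary_point_scale[OF k(1) that] k by simp
  show "regular_boundary_point 1 p \<Theta> \<xi>\<^sub>0" if "regular_boundary_point a p \<Theta> \<xi>\<^sub>0"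
    \<comment> \<open>Scaling by \<open>inverse k\<close> takes the coefficient
      \<open>a = k powr (p - 2)\<close> back to 1.\<close>
    using regular_boundary_point_scale[OF _ that, of "inverse k"]
      powr_mult_inverse_powr_cancel[OF k(1), of 1 "p - 2"] k by simp
qed

end
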